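(* Let $\mathbf{u}\in\{0,1\}^N$, $\overline u=\sum_{s=1}^N\mathbb{1}\{u_s=1\}$, $\gamma\ge0$, $\boldsymbol\delta\in\{0,1\}^I$, $c\in\mathbb{R}$. The exact null distribution of any count-based test statistic $T(\mathbf{N})$ can be written as $$\alpha(T,\mathbf{r},\mathbf{u})=\frac{\sum_{\mathbf{t}\in\Omega_{\mathbf{t}}}\sum_{\mathbf{q}\in\Omega_{\mathbf{q}}}\exp(\gamma\boldsymbol\delta^\top\mathbf{q})\,\operatorname{kernel}(\mathbf{t},\mathbf{q}\mid\mathbf{u},\mathbf{N}_{I\cdot},\mathbf{r})}{\sum_{\mathbf{q}\in\Omega_{\mathbf{q}}}\exp(\gamma\boldsymbol\delta^\top\mathbf{q})\,\operatorname{kernel}(\mathbf{q}\mid\mathbf{u},\mathbf{N}_{I\cdot})},$$ where $$\Omega_{\mathbf{q}}=\Big\{\mathbf{q}\in\mathbb{Z}_{\ge0}^I:\ \sum_{i=1}^Iq_i=\overline u,\ \max(0,\overline u+N_{i\cdot}-N)\le q_i\le\min(\overline u,N_{i\cdot})\ \forall i\Big\},$$ $$\Omega_{\mathbf{t}}=\Big\{\mathbf{t}\in\mathbb{Z}_{\ge0}^{I\times J}:\ T(\mathbf{t})\ge c,\ \sum_{i=1}^It_{ij}=N_{\cdot j},\ \sum_{j=1}^Jt_{ij}=N_{i\cdot}\ \forall i,j\Big\}.$$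
   Context: Fix integers $N$, $I\ge 2$, $J\ge 2$ and positive integers $N_{1\cdot},\dots,N_{I\cdot}$ with $\sum_i N_{i\cdot}=N$. Let $\mathcal{Z}(\mathbf{N}_{I\cdot})=\{\mathbf{z}\in\{1,\dots,I\}^N:\ |\{s:z_s=i\}|=N_{i\cdot}\ \forall i\}$. The outcome vector $\mathbf{r}\in\{1,\dots,J\}^N$ is fixed (sharp null hypothesis), and $N_{\cdot j}=|\{s:r_s=j\}|$. For $\mathbf{z}\in\mathcal{Z}(\mathbf{N}_{I\cdot})$, $\mathbf{N}(\mathbf{z},\mathbf{r})$ is the $I\times J$ table with entries $N_{ij}=\sum_{s=1}^N\mathbb{1}\{z_s=i,r_s=j\}$. A count-based test statistic is a real-valued function $T$ of the $I\times J$ table. For $\mathbf{u}\in[0,1]^N$, $$\alpha(T,\mathbf{r},\mathbf{u})=\frac{\sum_{\mathbf{z}\in\mathcal{Z}(\mathbf{N}_{I\cdot})}\mathbb{1}\{T(\mathbf{N}(\mathbf{z},\mathbf{r}))\ge c\}\exp\{\gamma\sum_{s=1}^N\delta_{z_s}u_s\}}{\sum_{\mathbf{b}\in\mathcal{Z}(\mathbf{N}_{I\cdot})}\exp\{\gamma\sum_{s=1}^N\delta_{b_s}u_s\}}.$$ The kernel functions are the cardinalities $$\operatorname{kernel}(\mathbf{q}\mid\mathbf{u},\mathbf{N}_{I\cdot})=\Big|\Big\{\mathbf{z}\in\mathcal{Z}(\mathbf{N}_{I\cdot}):\ \sum_{s=1}^N\mathbb{1}\{z_s=i,u_s=1\}=q_i\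 \forall i\Big\}\Big|,$$ $$\operatorname{kernel}(\mathbf{t},\mathbf{q}\mid\mathbf{u},\mathbf{N}_{I\cdot},\mathbf{r})=\Big|\Big\{\mathbf{z}\in\mathcal{Z}(\mathbf{N}_{I\cdot}):\ \sum_{s=1}^N\mathbb{1}\{z_s=i,u_s=1\}=q_i\ \forall i,\ \sum_{s=1}^N\mathbb{1}\{z_s=i,r_s=j\}=t_{ij}\ \forall i,j\Big\}\Big|.$$ *)

theory Defs
  imports "HOL-Analysis.Analysis"
begin

text \<open>
  The index sets \<open>{1..N}\<close> of units, \<open>{1..I}\<close> of treatments and \<open>{1..J}\<close> of outcomes are rendered
  by finite types \<open>'n\<close>, \<open>'i\<close> and \<open>'j\<close>, so that \<open>N = CARD('n)\<close>, \<open>I = CARD('i)\<close> and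
  \<open>J = CARD('j)\<close>. An \<open>I\<close> by \<open>J\<close> table \<open>t\<close> has type \<open>nat ^ 'j ^ 'i\<close>, with entries \<open>t $ i $ j\<close>.
  The vector \<open>m\<close> below holds the treatment margins \<open>N\<^sub>i\<^sub>.\<close>.
\<close>

definition assignments :: "nat ^ 'i \<Rightarrow> ('i::finite ^ 'n::finite) set" where
  "assignments m = {z. \<forall>i. card {s. z $ s = i} = m $ i}"

definition count_table :: "'i::finite ^ 'n::finite \<Rightarrow> 'j::finite ^ 'n \<Rightarrow> nat ^ 'j ^ 'i" where
  "count_table z r = (\<chi> i j. \<Sum>s\<in>UNIV. of_bool (z $ s = i \<and> r $ s = j))"

definition outcome_total :: "'j::finite ^ 'n::finite \<Rightarrow> 'j \<Rightarrow> nat" where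
  "outcome_total r j = card {s. r $ s = j}"

definition sens_weight :: "real \<Rightarrow> real ^ 'i \<Rightarrow> real ^ 'n \<Rightarrow> 'i::finite ^ 'n::finite \<Rightarrow> real" where
  "sens_weight \<gamma> \<delta> u z = exp (\<gamma> * (\<Sum>s\<in>UNIV. \<delta> $ (z $ s) * u $ s))"

definition alpha ::
  "nat ^ 'i \<Rightarrow> real \<Rightarrow> real ^ 'i \<Rightarrow> real \<Rightarrow> (nat ^ 'j ^ 'i \<Rightarrow> real)
     \<Rightarrow> 'j::finite ^ 'n::finite \<Rightarrow> real ^ 'n \<Rightarrow> real" where
  "alpha m \<gamma> \<delta> c T r u =
     (\<Sum>z\<in>assignments m. of_bool (T (count_table z r) \<ge> c) * sens_weight \<gamma> \<delta> u (z :: 'i::finite ^ 'n)) /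
     (\<Sum>b\<in>assignments m. sens_weight \<gamma> \<delta> u (b :: 'i ^ 'n))"

definition u_total :: "real ^ 'n::finite \<Rightarrow> nat" where
  "u_total u = (\<Sum>s\<in>UNIV. of_bool (u $ s = 1))"

definition kernel_q :: "nat ^ 'i \<Rightarrow> real ^ 'n \<Rightarrow> nat ^ 'i::finite \<Rightarrow> nat" where
  "kernel_q q u m =
     card {z :: 'i ^ 'n::finite. z \<in> assignments m \<and>
       (\<forall>i. (\<Sum>s\<in>UNIV. of_bool (z $ s = i \<and> u $ s = 1)) = q $ i)}"

definition kernel_tq ::
  "nat ^ 'j ^ 'i \<Rightarrow> nat ^ 'i \<Rightarrow> real ^ 'n \<Rightarrow> nat ^ 'i::finite \<Rightarrow> 'j::finite ^ 'n::finite \<Rightarrow> nat" where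
  "kernel_tq t q u m r =
     card {z :: 'i ^ 'n. z \<in> assignments m \<and>
       (\<forall>i. (\<Sum>s\<in>UNIV. of_bool (z $ s = i \<and> u $ s = 1)) = q $ i) \<and>
       (\<forall>i j. (\<Sum>s\<in>UNIV. of_bool (z $ s = i \<and> r $ s = j)) = t $ i $ j)}"

text \<open>The lower bound is taken in the integers, since \<open>u_total u + m $ i - N\<close> may be negative.\<close>

definition Omega_q :: "nat ^ 'i \<Rightarrow> real ^ 'n::finite \<Rightarrow> (nat ^ 'i::finite) set" where
  "Omega_q m u =
     {q. (\<Sum>i\<in>UNIV. q $ i) = u_total u \<and>
         (\<forall>i. max 0 (int (u_total u) + int (m $ i) - int CARD('n)) \<le> int (q $ i) \<and>
              q $ i \<le> min (u_total u) (m $ i))}"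

definition Omega_t ::
  "(nat ^ 'j ^ 'i \<Rightarrow> real) \<Rightarrow> real \<Rightarrow> nat ^ 'i \<Rightarrow> 'j::finite ^ 'n::finite
     \<Rightarrow> (nat ^ 'j ^ 'i::finite) set" where
  "Omega_t T c m r =
     {t. T t \<ge> c \<and>
         (\<forall>j. (\<Sum>i\<in>UNIV. t $ i $ j) = outcome_total r j) \<and>
         (\<forall>i. (\<Sum>j\<in>UNIV. t $ i $ j) = m $ i)}"

definition exp_tilt :: "real \<Rightarrow> real ^ 'i::finite \<Rightarrow> nat ^ 'i \<Rightarrow> real" where
  "exp_tilt \<gamma> \<delta> q = exp (\<gamma> * (\<delta> \<bullet> (\<chi> i. real (q $ i))))"

end

theory Submission
  imports Defs
begin

text \<open>
  For a binary \<open>u\<close> the weight of an assignment \<open>z\<close> depends only on the numbers \<open>q\<^sub>i\<close> of units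
  with \<open>u\<^sub>s = 1\<close> receiving treatment \<open>i\<close>, so both sums over assignments can be evaluated
  fibrewise, over the fibres of \<open>z \<mapsto> (t, q)\<close> in the numerator and of \<open>z \<mapsto> q\<close> in the
  denominator. The kernels are the fibre cardinalities, and all the values lie in
  \<open>\<Omega>\<^sub>t\<close> and \<open>\<Omega>\<^sub>q\<close>.
\<close>

definition exposed_counts :: "real ^ 'n \<Rightarrow> 'i::finite ^ 'n::finite \<Rightarrow> nat ^ 'i" where
  "exposed_counts u z = (\<chi> i. \<Sum>s\<in>UNIV. of_bool (z $ s = i \<and> u $ s = 1))"

text \<open>Provides finiteness of \<open>Omega_q\<close> and, applied once per index level, of
  \<open>Omega_t\<close>, so that sums over them are genuine.\<close>

lemma finite_vec_components:
  fixes B :: "'i::finite \<Rightarrow> 'a set"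
  assumes "\<And>i. finite (B i)"
  shows "finite {v :: 'a ^ 'i. \<forall>i. v $ i \<in> B i}"
proof -
  have "v \<in> vec_lambda ` (\<Pi>\<^sub>E i\<in>UNIV. B i)" if "\<forall>i. v $ i \<in> B i" for v :: "'a ^ 'i"
    using that by (intro image_eqI[of _ _ "vec_nth v"]) auto
  then have "{v :: 'a ^ 'i. \<forall>i. v $ i \<in> B i} \<subseteq> vec_lambda ` (\<Pi>\<^sub>E i\<in>UNIV. B i)"
    by blast
  then show ?thesis
    by (rule finite_subset) (simp add: finite_PiE assms)
qed

lemma finite_Omega_q: "finite (Omega_q m u)"
  by (rule finite_subset[OF _ finite_vec_components[of "\<lambda>i. {..m $ i}"]])
    (auto simp: Omega_q_def)

lemma finite_Omega_t:
  fixes T :: "nat ^ 'j::finite ^ 'i::finite \<Rightarrow> real"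
  shows "finite (Omega_t T c m r)"
proof (rule finite_subset)
  \<comment> \<open>Entries are nonnegative, so each is bounded by its row sum.\<close>
  have "t $ i $ j \<le> m $ i" if "t \<in> Omega_t T c m r" for t i j
    using that member_le_sum[of j UNIV "\<lambda>j. t $ i $ j"] by (auto simp: Omega_t_def)
  then show "Omega_t T c m r \<subseteq> {t. \<forall>i. t $ i \<in> {v. \<forall>j. v $ j \<in> {..m $ i}}}"
    by auto
  show "finite {t :: nat ^ 'j ^ 'i. \<forall>i. t $ i \<in> {v. \<forall>j. v $ j \<in> {..m $ i}}}"
    by (intro finite_vec_components) auto
qed

text \<open>Each unit falls in exactly one class. After exchanging sums, this evaluates the total of
  \<open>exposed_counts\<close> and both margins of a count table.\<close>

lemma sum_of_bool_fibre:
  "(\<Sum>i\<in>UNIV. of_bool (a = i \<and> P)) = (of_bool P :: nat)" for a :: "'i::finite"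
  by (cases P) (simp_all add: of_bool_def)

text \<open>The count for treatment \<open>i\<close> is the size of an intersection
  \<open>U \<inter> Z\<close>. The upper bound is monotonicity; the lower bound is
  inclusion-exclusion, since \<open>U \<union> Z\<close> has at most \<open>CARD('n)\<close>
  elements.\<close>

lemma exposed_counts_in_Omega_q:
  fixes z :: "'i::finite ^ 'n::finite"
  assumes "z \<in> assignments m"
  shows "exposed_counts u z \<in> Omega_q m u"
proof -
  have "(\<Sum>i\<in>UNIV. exposed_counts u z $ i) = u_total u"
    unfolding exposed_counts_def u_total_def vec_lambda_beta
    by (subst sum.swap) (simp only: sum_of_bool_fibre)
  moreover have "int (u_total u) + int (m $ i) - int CARD('n) \<le> int (exposed_counts u z $ i)
      \<and> exposed_counts u z $ i \<le> min (u_total u) (m $ i)" for i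
  proof -
    define U where "U = {s. u $ s = 1}"
    define Z where "Z = {s. z $ s = i}"
    have U: "u_total u = card U"
      by (simp add: u_total_def U_def)
    have Z: "m $ i = card Z"
      using assms by (simp add: assignments_def Z_def)
    have "{s. z $ s = i \<and> u $ s = 1} = U \<inter> Z"
      by (auto simp: U_def Z_def)
    then have UZ: "exposed_counts u z $ i = card (U \<inter> Z)"
      by (simp add: exposed_counts_def)
    have "card U + card Z = card (U \<union> Z) + card (U \<inter> Z)"
      by (rule card_Un_Int) auto
    moreover have "card (U \<union> Z) \<le> CARD('n)"
      by (rule card_mono) auto
    moreover have "card (U \<inter> Z) \<le> card U" "card (U \<inter> Z) \<le> card Z"
      by (auto intro: card_mono)
    ultimately show ?thesis
      unfolding U Z UZ by linarith
  qed
  ultimately show ?thesis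
    by (simp add: Omega_q_def)
qed

lemma count_table_in_Omega_t:
  fixes z :: "'i::finite ^ 'n::finite" and r :: "'j::finite ^ 'n"
  assumes "z \<in> assignments m" and "T (count_table z r) \<ge> c"
  shows "count_table z r \<in> Omega_t T c m r"
proof -
  have "(\<Sum>i\<in>UNIV. count_table z r $ i $ j) = outcome_total r j" for j
    unfolding count_table_def vec_lambda_beta
    by (subst sum.swap) (simp only: sum_of_bool_fibre, simp add: outcome_total_def)
  moreover have "(\<Sum>j\<in>UNIV. count_table z r $ i $ j) = m $ i" for i
    using assms(1) unfolding count_table_def vec_lambda_beta
    \<comment> \<open>The conjuncts are exchanged because the index summed over is now the outcome
      \<open>j\<close>, which \<open>sum_of_bool_fibre\<close> expects in the first
      conjunct.\<close>
    by (subst sum.swap, subst conj_commute)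
      (simp only: sum_of_bool_fibre, simp add: assignments_def)
  ultimately show ?thesis
    using assms(2) by (simp add: Omega_t_def)
qed

lemma sens_weight_eq_exp_tilt:
  fixes z :: "'i::finite ^ 'n::finite"
  assumes "\<forall>s. u $ s \<in> {0, 1}"
  shows "sens_weight \<gamma> \<delta> u z = exp_tilt \<gamma> \<delta> (exposed_counts u z)"
proof -
  have "\<delta> \<bullet> (\<chi> i. real (exposed_counts u z $ i))
      = (\<Sum>i\<in>UNIV. \<Sum>s\<in>UNIV. \<delta> $ i * of_bool (z $ s = i \<and> u $ s = 1))"
    \<comment> \<open>The counts must stay sums of indicators, not become cardinalities, so that the
      two summations can be exchanged.\<close>
    by (simp add: inner_vec_def exposed_counts_def sum_distrib_left del: sum_of_bool_eq)
  also have "\<dots> = (\<Sum>s\<in>UNIV. \<Sum>i\<in>UNIV. \<delta> $ i * of_bool (z $ s = i \<and> u $ s = 1))"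
    by (rule sum.swap)
  \<comment> \<open>Binarity of \<open>u\<close> enters here: \<open>u $ s\<close> equals the
    indicator of \<open>u $ s = 1\<close>.\<close>
  also have "\<dots> = (\<Sum>s\<in>UNIV. \<Sum>i\<in>UNIV. if z $ s = i then \<delta> $ i * u $ s else 0)"
    using assms by (intro sum.cong) auto
  finally show ?thesis
    by (simp add: sens_weight_def exp_tilt_def)
qed

lemma kernel_q_eq_card_fibre:
  "kernel_q q (u :: real ^ 'n::finite) m =
    card {z :: 'i::finite ^ 'n. z \<in> assignments m \<and> exposed_counts u z = q}"
  by (simp add: kernel_q_def exposed_counts_def vec_eq_iff)

lemma kernel_tq_eq_card_fibre:
  "kernel_tq t q u m (r :: 'j::finite ^ 'n::finite) =
    card {z :: 'i::finite ^ 'n. z \<in> assignments m \<and> exposed_counts u z = q \<and> count_table z r = t}"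
  by (simp add: kernel_tq_def exposed_counts_def count_table_def vec_eq_iff)

text \<open>\<open>w (g x)\<close> is constant on each fibre of \<open>g\<close>. Points of
  \<open>B\<close> outside the image have empty fibres and contribute 0.\<close>

lemma sum_eq_sum_card_fibres:
  fixes w :: "'b \<Rightarrow> real"
  assumes "finite A" "finite B" "g ` A \<subseteq> B"
  shows "(\<Sum>x\<in>A. w (g x)) = (\<Sum>y\<in>B. w y * real (card {x. x \<in> A \<and> g x = y}))"
  by (subst sum.group[OF assms, symmetric]) (simp add: mult.commute)

theorem theorem4:
  fixes m :: "nat ^ 'i::finite"
    and r :: "'j::finite ^ 'n::finite"
    and u :: "real ^ 'n"
    and T :: "nat ^ 'j ^ 'i \<Rightarrow> real"
    and \<gamma> c :: real
    and \<delta> :: "real ^ 'i"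
  assumes "CARD('i) \<ge> 2" and "CARD('j) \<ge> 2"
    and "\<forall>i. m $ i > 0" and "(\<Sum>i\<in>UNIV. m $ i) = CARD('n)"
    and "\<forall>s. u $ s \<in> {0, 1}"
    and "\<gamma> \<ge> 0"
    and "\<forall>i. \<delta> $ i \<in> {0, 1}"
  shows "alpha m \<gamma> \<delta> c T r u =
    (\<Sum>t\<in>Omega_t T c m r. \<Sum>q\<in>Omega_q m u. exp_tilt \<gamma> \<delta> q * real (kernel_tq t q u m r)) /
    (\<Sum>q\<in>Omega_q m u. exp_tilt \<gamma> \<delta> q * real (kernel_q q u m))"
proof -
  let ?A = "assignments m :: ('i ^ 'n) set"
  let ?B = "{z \<in> ?A. T (count_table z r) \<ge> c}"
  let ?w = "exp_tilt \<gamma> \<delta>"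
  note weight = sens_weight_eq_exp_tilt[OF assms(5)]
  have denominator: "(\<Sum>z\<in>?A. sens_weight \<gamma> \<delta> u z)
      = (\<Sum>q\<in>Omega_q m u. ?w q * real (kernel_q q u m))"
    unfolding weight kernel_q_eq_card_fibre
    by (rule sum_eq_sum_card_fibres)
      (auto simp: finite_Omega_q exposed_counts_in_Omega_q)
  \<comment> \<open>Membership of \<open>t\<close> in \<open>Omega_t\<close> includes
    \<open>T t \<ge> c\<close>, so the rejection condition in \<open>?B\<close> is automatic on the
    fibre over \<open>t\<close>.\<close>
  have fibre: "{z. z \<in> ?B \<and> (count_table z r, exposed_counts u z) = (t, q)}
      = {z. z \<in> ?A \<and> exposed_counts u z = q \<and> count_table z r = t}"
    if "t \<in> Omega_t T c m r" for t q
    using that by (auto simp: Omega_t_def)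
  \<comment> \<open>The weight is written as a function of the pair, through \<open>snd\<close>, so
    that the sum can be split over the joint fibres.\<close>
  have "(\<Sum>z\<in>?A. of_bool (T (count_table z r) \<ge> c) * sens_weight \<gamma> \<delta> u z)
      = (\<Sum>z\<in>?B. ?w (snd (count_table z r, exposed_counts u z)))"
    unfolding weight by (intro sum.mono_neutral_cong_right) auto
  also have "\<dots> = (\<Sum>p\<in>Omega_t T c m r \<times> Omega_q m u. ?w (snd p) *
      real (card {z. z \<in> ?B \<and> (count_table z r, exposed_counts u z) = p}))"
    by (rule sum_eq_sum_card_fibres)
      (auto simp: finite_Omega_q finite_Omega_t exposed_counts_in_Omega_q count_table_in_Omega_t)
  also have "\<dots> = (\<Sum>t\<in>Omega_t T c m r. \<Sum>q\<in>Omega_q m u. ?w q * real (kernel_tq t q u m r))"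
    unfolding kernel_tq_eq_card_fibre sum.cartesian_product
    by (rule sum.cong) (auto simp only: fibre snd_conv split: prod.splits)
  finally show ?thesis
    unfolding alpha_def denominator by simp
qed

end
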